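(* Let $Q=\{\pi_1,\ldots,\pi_d\}$ be a symmetric set of $d$ permutations of $X=\{1,2,\ldots,d+1\}$. Let $S_Q=\{s_1,\ldots,s_{d+1}\}$ be the generating set, defined by the wreath recursion given in the context, of the self-similar group $G_Q=\langle S_Q\rangle$ acting on $X^*$, and let $\Gamma_n$ ($n\ge 1$) be the action graph of $S_Q$ on $X^n$. Let $\Gamma$ be the graph of the action of $Q$ on $X$. Then for every $n\ge 1$, $$\Gamma_{n+1}=\Gamma_n\,ⓡ\,\Gamma ,$$ where $ⓡ$ denotes the replacement product, the vertex $(x,v)\in X\times X^n$ of the product is identified with $xv\in X^{n+1}$, and the edges of $\Gamma_n$ at each vertex $v\in X^n$ are labeled by the vertices of $\Gamma$ via $v[x]:=s_x(v)$, $x\in X$ (so the edge labeled $x$ at $v$ is labeled $\gamma(x)$ at $s_x(v)$, with $\gamma$ the involution of $X$ defined in the context). In particular, if $\Gamma$ is connected, then all the graphs $\Gamma_n$, $n\ge 1$, are connected.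
   Context: Graphs are regular, undirected, and may have loops and multiple edges. A set of permutations is symmetric if it is closed under inverses. Action graphs: if a finite family $S$ of generators, closed under inverses, acts on a set $V$, the action graph has vertex set $V$ and, for every $s\in S$ and $v\in V$, an edge between $v$ and $s(v)$; the edge given by $s$ at $v$ is the same undirected edge as the one given by $s^{-1}$ at $s(v)$, so the graph is $|S|$-regular (generators are counted as formal symbols). Equality of graphs is with multiplicities of edges. Wreath recursion: $X^*$ is the set of finite words over $X$. Let $\gamma$ be the involution on $X$ given by $\pi_{\gamma(x)}=\pi_x^{-1}$ for $x\in\{1,\ldots,d\}$ and $\gamma(d+1)=d+1$. The symbols $s_1,\ldots,s_{d+1}$ act on $X^*$ (left actions, fixing the empty word, preserving length) by $$s_i(xv)=\pi_i(x)\,v\quad (i=1,\ldots,d),\qquad s_{d+1}(xv)=\gamma(x)\,s_x(v),\qquad x\in X,\ v\in X^*.$$ These are invertible transformations with $s_i^{-1}=s_{\gamma(i)}$ for $i=1,\ldots,d$ and $s_{d+1}^2=e$; $G_Q$ is the group they generate under composition. Replacement product: let $\mathcal G$ be a $D$-regular graph and $\Gamma$ a $\delta$-regular graph on $D$ vertices. The edges at each vertex of $\mathcal G$ are labeled by the vertices of $\Gamma$ in one-to-one fashion; $v[x]$ denotes the neighbor of $v$ along the edge labeled $x$ at $v$. The replacement product $\mathcal G\,ⓡ\,\Gamma$ is the $(\delta+1)$-regular graph with vertex set $V(\Gamma)\times V(\mathcal G)$ and the following edges: (1) for every edge $x - y$ of $\Gamma$ and every $v\in V(\mathcal G)$ an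 edge $(x,v) - (y,v)$; (2) for every edge of $\mathcal G$ joining $v$ and $u$ that is labeled $x$ at $v$ and $y$ at $u$, an edge $(x,v) - (y,u)$. The product depends on the chosen labeling. *)

theory Defs
  imports "Graph_Theory.Graph_Theory" "HOL-Library.Multiset" "HOL-Combinatorics.Permutations"
begin

section \<open>Undirected multigraphs\<close>

text \<open>
  An undirected graph with loops and multiple edges is a digraph in which every undirected edge
  is represented by its two orientations, exchanged by the reversal \<open>arev\<close>. In contrast to
  \<^locale>\<open>bidirected_digraph\<close>, an arc may be its own reverse: it is then a loop that contributes
  only 1 to the degree of its vertex. Action graphs contain such loops (an involution
  fixing a point), and they are needed for an action graph to be regular of degree the number of
  generators.
\<close>

record ('a, 'b) ugraph = "('a, 'b) pre_digraph" +
  arev :: "'b \<Rightarrow> 'b"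

definition wf_ugraph :: "('a, 'b) ugraph \<Rightarrow> bool" where
  "wf_ugraph G \<longleftrightarrow> fin_digraph (pre_digraph.truncate G) \<and>
     (\<forall>a \<in> arcs G. arev G a \<in> arcs G \<and> arev G (arev G a) = a \<and> tail G (arev G a) = head G a)"

definition uconnected :: "('a, 'b) ugraph \<Rightarrow> bool" where
  "uconnected G \<longleftrightarrow> Digraph_Component.connected (pre_digraph.truncate G)"

definition edges :: "('a, 'b) ugraph \<Rightarrow> 'b set set" where
  "edges G = (\<lambda>a. {a, arev G a}) ` arcs G"

text \<open>
  The ends of an edge: \<open>{#u, v#}\<close> for an edge between \<open>u\<close> and \<open>v\<close> (also for \<open>u = v\<close>), and \<open>{#v#}\<close>
  for a loop at \<open>v\<close> consisting of a single self-reverse arc. The degree of a vertex \<open>v\<close> is thus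
  the sum over all edges of the multiplicity of \<open>v\<close> in the ends.
\<close>

definition ends :: "('a, 'b) ugraph \<Rightarrow> 'b set \<Rightarrow> 'a multiset" where
  "ends G e = image_mset (tail G) (mset_set e)"

definition edge_mset :: "('a, 'b) ugraph \<Rightarrow> 'a multiset multiset" where
  "edge_mset G = image_mset (ends G) (mset_set (edges G))"

text \<open>
  Equality of (finite) graphs: the same vertices, and the same edges with multiplicities. Names
  of arcs are irrelevant.
\<close>

definition same_graph :: "('a, 'b) ugraph \<Rightarrow> ('a, 'c) ugraph \<Rightarrow> bool" where
  "same_graph G H \<longleftrightarrow> verts G = verts H \<and> edge_mset G = edge_mset H"

definition rename_verts :: "('a \<Rightarrow> 'c) \<Rightarrow> ('a, 'b) ugraph \<Rightarrow> ('c, 'b) ugraph" where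
  "rename_verts f G =
     \<lparr>verts = f ` verts G, arcs = arcs G, tail = f \<circ> tail G, head = f \<circ> head G, arev = arev G\<rparr>"


section \<open>Action graphs\<close>

text \<open>
  \<open>S\<close> is the set of generators (as formal symbols), \<open>i\<close> the formal inversion on \<open>S\<close>, and
  \<open>act s\<close> the transformation of \<open>V\<close> given by \<open>s\<close>.
\<close>

definition action_graph ::
  "'s set \<Rightarrow> ('s \<Rightarrow> 's) \<Rightarrow> ('s \<Rightarrow> 'v \<Rightarrow> 'v) \<Rightarrow> 'v set \<Rightarrow> ('v, 's \<times> 'v) ugraph" where
  "action_graph S i act V =
     \<lparr>verts = V, arcs = S \<times> V, tail = snd, head = (\<lambda>(s, v). act s v),
      arev = (\<lambda>(s, v). (i s, act s v))\<rparr>"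

lemma wf_action_graph:
  assumes "finite S" "finite V"
    and "\<And>s. s \<in> S \<Longrightarrow> i s \<in> S" "\<And>s. s \<in> S \<Longrightarrow> i (i s) = s"
    and "\<And>s v. s \<in> S \<Longrightarrow> v \<in> V \<Longrightarrow> act s v \<in> V"
    and "\<And>s v. s \<in> S \<Longrightarrow> v \<in> V \<Longrightarrow> act (i s) (act s v) = v"
  shows "wf_ugraph (action_graph S i act V)"
  using assms
  by (auto simp: wf_ugraph_def action_graph_def pre_digraph.truncate_def
      fin_digraph_def wf_digraph_def fin_digraph_axioms_def)


section \<open>The replacement product\<close>

text \<open>
  A labeling assigns a label to every arc; the label of an arc \<open>a\<close> is the label of the edge
  \<open>{a, arev G a}\<close> at the vertex \<open>tail G a\<close>.
\<close>

definition edge_labeling :: "('a, 'b) ugraph \<Rightarrow> ('b \<Rightarrow> 'l) \<Rightarrow> 'l set \<Rightarrow> bool" where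
  "edge_labeling G lab L \<longleftrightarrow> (\<forall>v \<in> verts G. bij_betw lab {a \<in> arcs G. tail G a = v} L)"

text \<open>
  \<open>replacement_product G lab H\<close> is meant for graphs \<open>G\<close>, \<open>H\<close> with
  \<open>edge_labeling G lab (verts H)\<close>.
\<close>

definition replacement_product ::
  "('a, 'b) ugraph \<Rightarrow> ('b \<Rightarrow> 'x) \<Rightarrow> ('x, 'c) ugraph \<Rightarrow> ('x \<times> 'a, 'c \<times> 'a + 'b) ugraph" where
  "replacement_product G lab H =
     \<lparr>verts = verts H \<times> verts G,
      arcs = (arcs H \<times> verts G) <+> arcs G,
      tail = case_sum (\<lambda>(b, v). (tail H b, v)) (\<lambda>a. (lab a, tail G a)),
      head = case_sum (\<lambda>(b, v). (head H b, v)) (\<lambda>a. (lab (arev G a), head G a)),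
      arev = case_sum (\<lambda>(b, v). Inl (arev H b, v)) (\<lambda>a. Inr (arev G a))\<rparr>"

lemma wf_replacement_product:
  assumes G: "wf_ugraph G" and H: "wf_ugraph H" and lab: "edge_labeling G lab (verts H)"
  shows "wf_ugraph (replacement_product G lab H)"
proof -
  have t: "tail G a \<in> verts G" "head G a \<in> verts G" if "a \<in> arcs G" for a
    using G that
    by (auto simp: wf_ugraph_def pre_digraph.truncate_def fin_digraph_def wf_digraph_def)
  have "lab a \<in> verts H" if "a \<in> arcs G" for a
    using lab t(1)[OF that] that by (auto simp: edge_labeling_def bij_betw_def)
  with t G H show ?thesis
    by (auto simp: wf_ugraph_def replacement_product_def pre_digraph.truncate_def
        fin_digraph_def wf_digraph_def fin_digraph_axioms_def split: sum.splits)
qed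


section \<open>The wreath recursion\<close>

text \<open>
  The letters are \<open>1, \<dots>, d + 1\<close> and \<open>\<pi> i\<close>, for \<open>i = 1, \<dots>, d\<close>, is the \<open>i\<close>-th element of the
  symmetric set \<open>Q\<close>; a permutation of the letters is a function on the naturals that fixes
  everything else. Values of \<open>\<pi>\<close> outside \<open>{1..d}\<close> are never used.
\<close>

definition alphabet :: "nat \<Rightarrow> nat set" where
  "alphabet d = {1..d + 1}"

definition words :: "nat \<Rightarrow> nat \<Rightarrow> nat list set" where
  "words d n = {w \<in> lists (alphabet d). length w = n}"

definition gam :: "nat \<Rightarrow> (nat \<Rightarrow> nat \<Rightarrow> nat) \<Rightarrow> nat \<Rightarrow> nat" where
  "gam d \<pi> x = (if x \<in> {1..d} then THE y. y \<in> {1..d} \<and> \<pi> y = inv (\<pi> x) else x)"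

fun gen :: "nat \<Rightarrow> (nat \<Rightarrow> nat \<Rightarrow> nat) \<Rightarrow> nat \<Rightarrow> nat list \<Rightarrow> nat list" where
  "gen d \<pi> i [] = []"
| "gen d \<pi> i (x # v) = (if i = d + 1 then gam d \<pi> x # gen d \<pi> x v else \<pi> i x # v)"

text \<open>
  The generators are indexed by the letters, and \<open>gam\<close> is at the same time their formal
  inversion: \<open>gen_inverse\<close> below.
\<close>

definition wreath_graph :: "nat \<Rightarrow> (nat \<Rightarrow> nat \<Rightarrow> nat) \<Rightarrow> nat \<Rightarrow> (nat list, nat \<times> nat list) ugraph" where
  "wreath_graph d \<pi> n = action_graph (alphabet d) (gam d \<pi>) (gen d \<pi>) (words d n)"

definition perm_graph :: "nat \<Rightarrow> (nat \<Rightarrow> nat) set \<Rightarrow> (nat, (nat \<Rightarrow> nat) \<times> nat) ugraph" where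
  "perm_graph d Q = action_graph Q inv (\<lambda>p. p) (alphabet d)"

text \<open>
  The arcs of \<^term>\<open>wreath_graph d \<pi> n\<close> leaving \<open>v\<close> are the pairs \<open>(x, v)\<close> with \<open>x\<close> a letter. The
  labeling for which the neighbor \<open>v[x]\<close> is \<open>gen d \<pi> x v\<close> is therefore \<^const>\<open>fst\<close>.
\<close>

lemma wreath_graph_labeling:
  "edge_labeling (wreath_graph d \<pi> n) fst (verts (perm_graph d Q))"
  by (auto simp: edge_labeling_def wreath_graph_def perm_graph_def action_graph_def
      bij_betw_def inj_on_def image_iff)

lemma wreath_graph_label:
  assumes "v \<in> words d n" "x \<in> alphabet d"
  shows "{a \<in> arcs (wreath_graph d \<pi> n). tail (wreath_graph d \<pi> n) a = v \<and> fst a = x} = {(x, v)}"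
    and "head (wreath_graph d \<pi> n) (x, v) = gen d \<pi> x v"
    and "fst (arev (wreath_graph d \<pi> n) (x, v)) = gam d \<pi> x"
  using assms by (auto simp: wreath_graph_def action_graph_def)

lemma
  assumes bij: "bij_betw \<pi> {1..d} Q"
    and perm: "\<And>p. p \<in> Q \<Longrightarrow> p permutes alphabet d"
    and symm: "\<And>p. p \<in> Q \<Longrightarrow> inv p \<in> Q"
  shows gam_in: "x \<in> {1..d} \<Longrightarrow> gam d \<pi> x \<in> {1..d}"
    and perm_gam: "x \<in> {1..d} \<Longrightarrow> \<pi> (gam d \<pi> x) = inv (\<pi> x)"
    and gam_gam: "gam d \<pi> (gam d \<pi> x) = x"
    and gen_in_words: "i \<in> alphabet d \<Longrightarrow> w \<in> words d n \<Longrightarrow> gen d \<pi> i w \<in> words d n"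
    and gen_inverse: "i \<in> alphabet d \<Longrightarrow> w \<in> words d n \<Longrightarrow> gen d \<pi> (gam d \<pi> i) (gen d \<pi> i w) = w"
    and wf_perm_graph: "wf_ugraph (perm_graph d Q)"
    and wf_wreath_graph: "wf_ugraph (wreath_graph d \<pi> n)"
proof -
  have inj: "inj_on \<pi> {1..d}" and im: "\<pi> ` {1..d} = Q"
    using bij by (auto simp: bij_betw_def)
  have *: "gam d \<pi> x \<in> {1..d} \<and> \<pi> (gam d \<pi> x) = inv (\<pi> x)" if x: "x \<in> {1..d}" for x
  proof -
    have "inv (\<pi> x) \<in> \<pi> ` {1..d}"
      using symm im x by blast
    then obtain y where "y \<in> {1..d}" "\<pi> y = inv (\<pi> x)"
      by force
    then have "\<exists>!y. y \<in> {1..d} \<and> \<pi> y = inv (\<pi> x)"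
      using inj by (metis inj_onD)
    from theI'[OF this] show ?thesis
      using x by (simp add: gam_def)
  qed
  show gin: "gam d \<pi> x \<in> {1..d}" if "x \<in> {1..d}" for x
    using * that by blast
  show pg: "\<pi> (gam d \<pi> x) = inv (\<pi> x)" if "x \<in> {1..d}" for x
    using * that by blast
  have p: "\<pi> x permutes alphabet d" if "x \<in> {1..d}" for x
    using perm im that by blast
  show gg: "gam d \<pi> (gam d \<pi> x) = x" for x
  proof (cases "x \<in> {1..d}")
    case True
    then have "\<pi> (gam d \<pi> (gam d \<pi> x)) = \<pi> x"
      using pg[OF True] pg[OF gin[OF True]] permutes_inv_inv[OF p[OF True]] by simp
    then show ?thesis
      using inj gin True by (meson inj_onD)
  next
    case False
    then have "gam d \<pi> x = x"
      unfolding gam_def by (rule if_not_P)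
    then show ?thesis
      by simp
  qed
  have split: "i = d + 1 \<or> i \<in> {1..d}" if "i \<in> alphabet d" for i
    using that by (auto simp: alphabet_def)
  have last: "gam d \<pi> (d + 1) = d + 1"
    by (simp add: gam_def)
  have gal: "gam d \<pi> i \<in> alphabet d" if "i \<in> alphabet d" for i
    using split[OF that] last gin[of i] that by (auto simp: alphabet_def)
  show gw: "gen d \<pi> i w \<in> words d n" if "i \<in> alphabet d" "w \<in> words d n" for i w n
    using that
  proof (induction w arbitrary: i n)
    case (Cons x v)
    then have x: "x \<in> alphabet d" and v: "v \<in> words d (length v)"
      by (auto simp: words_def)
    have "gen d \<pi> x v \<in> words d (length v)"
      using Cons.IH x v by blast
    moreover have "\<pi> i x \<in> alphabet d" if "i \<noteq> d + 1"
      using split[OF Cons.prems(1)] that p[of i] x by (auto simp: permutes_in_image)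
    ultimately show ?case
      using Cons.prems x gal by (auto simp: words_def)
  qed simp
  show gi: "gen d \<pi> (gam d \<pi> i) (gen d \<pi> i w) = w" if "i \<in> alphabet d" "w \<in> words d n" for i w n
    using that
  proof (induction w arbitrary: i n)
    case (Cons x v)
    then have x: "x \<in> alphabet d" and v: "v \<in> words d (length v)"
      by (auto simp: words_def)
    show ?case
    proof (cases "i = d + 1")
      case True
      then show ?thesis
        using Cons.IH[OF x v] last gg by simp
    next
      case False
      then have i: "i \<in> {1..d}"
        using split Cons.prems by blast
      then have "gam d \<pi> i \<noteq> d + 1"
        using gin[OF i] by auto
      then show ?thesis
        using False pg[OF i] permutes_inverses(2)[OF p[OF i]] by simp
    qed
  qed simp
  have fin: "finite (alphabet d)"
    by (simp add: alphabet_def)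
  then have "finite (words d n)"
    using finite_lists_length_eq[of "alphabet d" n] by (simp add: words_def lists_eq_set Collect_conj_eq)
  then show "wf_ugraph (wreath_graph d \<pi> n)"
    unfolding wreath_graph_def using fin gal gg gw gi
    by (intro wf_action_graph) auto
  have "finite Q"
    using im by (metis finite_atLeastAtMost finite_imageI)
  then show "wf_ugraph (perm_graph d Q)"
    unfolding perm_graph_def using fin symm
    by (intro wf_action_graph)
      (simp_all add: permutes_inv_inv[OF perm] permutes_in_image[OF perm] permutes_inverses(2)[OF perm])
qed

end

theory Submission
  imports Defs
begin

text \<open>
  Splitting off the first letter maps the arc \<open>s\<^sub>i\<close>, \<open>i \<le> d\<close>, at \<open>xv\<close> to the arc of \<open>\<Gamma>\<close> given by \<open>\<pi>\<^sub>i\<close> at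
  \<open>x\<close> in the copy of \<open>\<Gamma>\<close> over \<open>v\<close>, and the arc \<open>s\<^sub>d\<^sub>+\<^sub>1\<close> at \<open>xv\<close> to the arc of \<open>\<Gamma>\<^sub>n\<close> labeled \<open>x\<close> at \<open>v\<close>.
  This bijection of arcs respects tails and reversal, so it preserves the edges with their ends.
  A replacement product of connected graphs is connected, because the fibres over the vertices
  of the first factor are connected and every arc of that factor joins two fibres; as \<open>\<Gamma>\<^sub>0\<close> is a
  single vertex, connectedness of all \<open>\<Gamma>\<^sub>n\<close> follows by induction.
\<close>

lemma wf_ugraphD:
  assumes "wf_ugraph G" "a \<in> arcs G"
  shows "tail G a \<in> verts G" "head G a \<in> verts G" "arev G a \<in> arcs G"
    "arev G (arev G a) = a" "tail G (arev G a) = head G a" "head G (arev G a) = tail G a"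
proof -
  show "tail G a \<in> verts G" "head G a \<in> verts G"
    using assms by (auto simp: wf_ugraph_def pre_digraph.truncate_def fin_digraph_def wf_digraph_def)
  show "arev G a \<in> arcs G" "arev G (arev G a) = a" "tail G (arev G a) = head G a"
    "head G (arev G a) = tail G a"
    using assms unfolding wf_ugraph_def by metis+
qed

lemma wf_rename_verts: "wf_ugraph G \<Longrightarrow> wf_ugraph (rename_verts f G)"
  by (auto simp: wf_ugraph_def rename_verts_def pre_digraph.truncate_def fin_digraph_def
      wf_digraph_def fin_digraph_axioms_def)

text \<open>Vertices stay fixed and only arcs are renamed, which is the freedom that
  \<open>same_graph\<close> leaves. Heads are determined by tails and reversal: the head of an arc
  is the tail of its reverse.\<close>

locale ugraph_iso =
  fixes G :: "('a, 'b) ugraph" and H :: "('a, 'c) ugraph" and \<phi> :: "'b \<Rightarrow> 'c"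
  assumes wf_G: "wf_ugraph G" and wf_H: "wf_ugraph H"
    and verts_eq: "verts G = verts H"
    and bij: "bij_betw \<phi> (arcs G) (arcs H)"
    and tail_map: "a \<in> arcs G \<Longrightarrow> tail H (\<phi> a) = tail G a"
    and arev_map: "a \<in> arcs G \<Longrightarrow> arev H (\<phi> a) = \<phi> (arev G a)"
begin

lemma head_map: "a \<in> arcs G \<Longrightarrow> head H (\<phi> a) = head G a"
  using wf_ugraphD(3,5)[OF wf_G] wf_ugraphD(5)[OF wf_H] bij_betwE[OF bij] tail_map arev_map
  by metis

lemma inj: "inj_on \<phi> (arcs G)" and arcs_image: "arcs H = \<phi> ` arcs G"
  using bij by (auto simp: bij_betw_def)

lemma same_graph: "same_graph G H"
proof -
  have sub: "e \<subseteq> arcs G" if "e \<in> edges G" for e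
    using that wf_ugraphD(3)[OF wf_G] by (auto simp: edges_def)
  have "edges H = (\<lambda>a. \<phi> ` {a, arev G a}) ` arcs G"
    unfolding edges_def arcs_image image_image by (intro image_cong) (auto simp: arev_map)
  then have edges: "edges H = image \<phi> ` edges G"
    by (simp add: edges_def image_image)
  \<comment> \<open>Distinct edges must not merge, or multiplicities in \<open>edge_mset\<close>
    would drop.\<close>
  have inj_edges: "inj_on (image \<phi>) (edges G)"
    using inj_on_subset[OF inj_on_image_Pow[OF inj]] sub by blast
  \<comment> \<open>As \<phi> is injective on \<open>e\<close>, a self-reverse loop stays a single
    arc and a two-arc edge keeps both arcs, so each end is counted equally often.\<close>
  have ends: "ends H (\<phi> ` e) = ends G e" if "e \<in> edges G" for e
  proof -
    have fin: "finite e"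
      using that by (auto simp: edges_def)
    have "ends H (\<phi> ` e) = image_mset (tail H) (image_mset \<phi> (mset_set e))"
      unfolding ends_def using inj_on_subset[OF inj sub[OF that]] by (simp add: image_mset_mset_set)
    also have "\<dots> = ends G e"
      unfolding ends_def multiset.map_comp
      using sub[OF that] fin by (intro image_mset_cong) (auto simp: tail_map)
    finally show ?thesis .
  qed
  have fin: "finite (edges G)"
    using wf_G by (simp add: edges_def wf_ugraph_def fin_digraph_def fin_digraph_axioms_def
        pre_digraph.truncate_def)
  have "edge_mset H = image_mset (ends H) (image_mset (image \<phi>) (mset_set (edges G)))"
    unfolding edge_mset_def edges using inj_edges by (simp add: image_mset_mset_set)
  also have "\<dots> = edge_mset G"
    unfolding edge_mset_def multiset.map_comp
    using fin by (intro image_mset_cong) (auto simp: ends)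
  finally show ?thesis
    by (simp add: same_graph_def verts_eq)
qed

end

text \<open>This is the relation to which library connectedness unfolds by
  \<open>connected_conv\<close>, hence the symmetric closure.\<close>

definition joined :: "('a, 'b) ugraph \<Rightarrow> 'a \<Rightarrow> 'a \<Rightarrow> bool" where
  "joined G u v \<longleftrightarrow> (u, v) \<in> rtrancl_on (verts G) ((arcs_ends (pre_digraph.truncate G))\<^sup>s)"

lemma uconnected_iff_joined:
  "uconnected G \<longleftrightarrow> verts G \<noteq> {} \<and> (\<forall>u \<in> verts G. \<forall>v \<in> verts G. joined G u v)"
  by (simp add: uconnected_def connected_conv joined_def pre_digraph.truncate_def)

lemma joined_refl: "v \<in> verts G \<Longrightarrow> joined G v v"
  by (simp add: joined_def)

lemma joined_trans [trans]: "joined G u v \<Longrightarrow> joined G v w \<Longrightarrow> joined G u w"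
  unfolding joined_def by (rule rtrancl_on_trans)

lemma joined_arc: "wf_ugraph G \<Longrightarrow> a \<in> arcs G \<Longrightarrow> joined G (tail G a) (head G a)"
  unfolding joined_def using wf_ugraphD(1,2)[of G a]
  by (intro rtrancl_on_into_rtrancl_on[OF rtrancl_on_refl])
    (auto simp: symcl_def arcs_ends_conv pre_digraph.truncate_def)

text \<open>A step against the arc \<open>a\<close> is a step along \<open>arev G a\<close>, so the
  rule asks for forward steps only.\<close>

lemma joined_induct [consumes 2, case_names refl arc]:
  assumes "wf_ugraph G" "joined G u v"
    and refl: "u \<in> verts G \<Longrightarrow> P u"
    and arc: "\<And>a. a \<in> arcs G \<Longrightarrow> P (tail G a) \<Longrightarrow> P (head G a)"
  shows "P v"
  using assms(2) unfolding joined_def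
proof (induction rule: rtrancl_on_induct)
  case (step y z)
  then obtain a where "a \<in> arcs G" "y = tail G a \<and> z = head G a \<or> z = tail G a \<and> y = head G a"
    by (auto simp: symcl_def arcs_ends_conv pre_digraph.truncate_def)
  then show ?case
    using arc[of a] arc[of "arev G a"] wf_ugraphD[OF assms(1)] step.IH by auto
qed (rule refl)

text \<open>The image of a path is a path, whether or not \<open>f\<close> is injective.\<close>

lemma uconnected_rename_verts:
  assumes "wf_ugraph G" "uconnected G"
  shows "uconnected (rename_verts f G)"
proof -
  have "joined (rename_verts f G) (f u) (f v)" if "joined G u v" for u v
    using assms(1) that
  proof (induction rule: joined_induct)
    case (arc a)
    then show ?case
      using joined_arc[OF wf_rename_verts[OF assms(1)], of a f]
      by (auto simp: rename_verts_def intro: joined_trans)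
  qed (simp add: joined_refl rename_verts_def)
  then show ?thesis
    using assms(2) by (auto simp: uconnected_iff_joined rename_verts_def)
qed

text \<open>Connectedness sees arcs only through their pairs of tail and head, and these pairs
  coincide.\<close>

lemma (in ugraph_iso) uconnected_iff: "uconnected G \<longleftrightarrow> uconnected H"
proof -
  have "arcs_ends (pre_digraph.truncate G) = arcs_ends (pre_digraph.truncate H)"
    by (auto simp: arcs_ends_conv pre_digraph.truncate_def arcs_image tail_map head_map image_image)
  then show ?thesis
    by (simp add: uconnected_iff_joined joined_def verts_eq)
qed

lemma uconnected_replacement_product:
  assumes G: "wf_ugraph G" "uconnected G" and H: "wf_ugraph H" "uconnected H"
    and lab: "edge_labeling G lab (verts H)"
  shows "uconnected (replacement_product G lab H)" (is "uconnected ?P")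
proof -
  note wf = wf_replacement_product[OF G(1) H(1) lab]
  have lab_in: "lab a \<in> verts H" if "a \<in> arcs G" for a
    using lab wf_ugraphD(1)[OF G(1) that] that by (auto simp: edge_labeling_def bij_betw_def)
  have fibre: "joined ?P (x, v) (y, v)" if "x \<in> verts H" "y \<in> verts H" "v \<in> verts G" for x y v
  proof -
    have "joined H x y"
      using H(2) that by (simp add: uconnected_iff_joined)
    with H(1) show ?thesis
    proof (induction rule: joined_induct)
      case (arc a)
      then show ?case
        using joined_arc[OF wf, of "Inl (a, v)"] that(3)
        by (auto simp: replacement_product_def intro: joined_trans)
    qed (simp add: joined_refl replacement_product_def that)
  qed
  have "joined ?P (x, u) (y, v)"
    if x: "x \<in> verts H" and y: "y \<in> verts H" and "u \<in> verts G" "v \<in> verts G" for x y u v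
  proof -
    have "joined G u v"
      using G(2) that by (simp add: uconnected_iff_joined)
    \<comment> \<open>The letter \<open>y\<close> is quantified inside the induction: to cross
      \<open>a\<close>, the path must first reach \<open>lab a\<close> in the fibre over
      \<open>tail G a\<close>.\<close>
    with G(1) have "\<forall>y \<in> verts H. joined ?P (x, u) (y, v)"
    proof (induction rule: joined_induct)
      case (arc a)
      note a = wf_ugraphD[OF G(1) arc(1)]
      show ?case
      proof
        fix y assume y: "y \<in> verts H"
        have "joined ?P (x, u) (lab a, tail G a)"
          using arc lab_in by blast
        also have "joined ?P (lab a, tail G a) (lab (arev G a), head G a)"
          using joined_arc[OF wf, of "Inr a"] arc(1) by (auto simp: replacement_product_def)
        also have "joined ?P (lab (arev G a), head G a) (y, head G a)"
          using fibre lab_in a y by blast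
        finally show "joined ?P (x, u) (y, head G a)" .
      qed
    qed (simp add: fibre x)
    with y show ?thesis
      by blast
  qed
  then show ?thesis
    using G(2) H(2) by (auto simp: uconnected_iff_joined replacement_product_def)
qed

lemma ugraph_iso_wreath_graph_Suc:
  fixes d :: nat and \<pi> :: "nat \<Rightarrow> nat \<Rightarrow> nat" and Q :: "(nat \<Rightarrow> nat) set"
  assumes bij: "bij_betw \<pi> {1..d} Q"
    and perm: "\<And>p. p \<in> Q \<Longrightarrow> p permutes alphabet d"
    and symm: "\<And>p. p \<in> Q \<Longrightarrow> inv p \<in> Q"
  shows "ugraph_iso (wreath_graph d \<pi> (Suc n))
    (rename_verts (\<lambda>(x, v). x # v)
      (replacement_product (wreath_graph d \<pi> n) fst (perm_graph d Q)))
    (\<lambda>(s, w). if s = d + 1 then Inr (hd w, tl w) else Inl ((\<pi> s, hd w), tl w))"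
    (is "ugraph_iso ?G ?H ?\<phi>")
proof
  note defs = wreath_graph_def perm_graph_def action_graph_def replacement_product_def
    rename_verts_def
  have words_Suc: "words d (Suc n) = (\<lambda>(x, v). x # v) ` (alphabet d \<times> words d n)"
    by (auto simp: words_def image_iff length_Suc_conv)
  have alphabet: "alphabet d = insert (d + 1) {1..d}"
    by (auto simp: alphabet_def)
  have inj: "inj_on \<pi> {1..d}" and im: "Q = \<pi> ` {1..d}"
    using bij by (auto simp: bij_betw_def)
  show "wf_ugraph ?G"
    using assms by (rule wf_wreath_graph)
  show "wf_ugraph ?H"
    using wf_wreath_graph[OF assms] wf_perm_graph[OF assms] wreath_graph_labeling
    by (blast intro: wf_rename_verts wf_replacement_product)
  show "verts ?G = verts ?H"
    by (simp add: defs words_Suc)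
  show "bij_betw ?\<phi> (arcs ?G) (arcs ?H)"
  proof (rule bij_betwI')
    \<comment> \<open>Arcs of \<open>perm_graph\<close> carry permutations rather than indices, so
      injectivity of \<pi> is what separates the arcs of different generators.\<close>
    fix a b assume "a \<in> arcs ?G" "b \<in> arcs ?G"
    then show "?\<phi> a = ?\<phi> b \<longleftrightarrow> a = b"
      using inj_on_eq_iff[OF inj] by (auto simp: defs words_Suc alphabet)
  next
    fix a assume "a \<in> arcs ?G"
    then show "?\<phi> a \<in> arcs ?H"
      by (auto simp: defs words_Suc im alphabet)
  next
    fix b assume "b \<in> arcs ?H"
    then consider s x v where "s \<in> {1..d}" "x \<in> alphabet d" "v \<in> words d n" "b = Inl ((\<pi> s, x), v)"
      | x v where "x \<in> alphabet d" "v \<in> words d n" "b = Inr (x, v)"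
      by (auto simp: defs im)
    then show "\<exists>a \<in> arcs ?G. b = ?\<phi> a"
    proof cases
      case (1 s x v)
      then show ?thesis
        by (intro bexI[of _ "(s, x # v)"]) (auto simp: defs words_Suc alphabet)
    next
      case (2 x v)
      then show ?thesis
        by (intro bexI[of _ "(d + 1, x # v)"]) (auto simp: defs words_Suc alphabet)
    qed
  qed
  fix a assume "a \<in> arcs ?G"
  then obtain s x v where a: "a = (s, x # v)" "s \<in> alphabet d"
    by (auto simp: defs words_Suc)
  show "tail ?H (?\<phi> a) = tail ?G a"
    by (simp add: defs a)
  show "arev ?H (?\<phi> a) = ?\<phi> (arev ?G a)"
  proof (cases "s = d + 1")
    \<comment> \<open>Since \<open>gam\<close> fixes \<open>d + 1\<close>, the reverse arc is again
      sent to an \<open>Inr\<close>, namely \<open>(gam d \<pi> x, gen d \<pi> x v)\<close>, the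
      reverse of \<open>(x, v)\<close> in the graph on words of length \<open>n\<close>.\<close>
    case True
    then show ?thesis
      by (simp add: defs a gam_def)
  next
    \<comment> \<open>Here \<open>gam d \<pi> s\<close> stays in \<open>{1..d}\<close>, so the
      reverse arc lands in the same copy of \<open>perm_graph\<close>, with permutation
      \<open>inv (\<pi> s)\<close> at \<open>\<pi> s x\<close>.\<close>
    case False
    then have s: "s \<in> {1..d}"
      using a(2) alphabet by simp
    then show ?thesis
      using gam_in[OF assms s] perm_gam[OF assms s] False by (auto simp: defs a(1))
  qed
qed

lemma uconnected_wreath_graph:
  assumes "bij_betw \<pi> {1..d} Q"
    and "\<And>p. p \<in> Q \<Longrightarrow> p permutes alphabet d"
    and "\<And>p. p \<in> Q \<Longrightarrow> inv p \<in> Q"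
    and "uconnected (perm_graph d Q)"
  shows "uconnected (wreath_graph d \<pi> n)"
proof (induction n)
  case 0
  have "words d 0 = {[]}"
    by (auto simp: words_def)
  then show ?case
    by (simp add: uconnected_iff_joined wreath_graph_def action_graph_def joined_refl)
next
  case (Suc n)
  note wf = wf_wreath_graph[OF assms(1-3)] wf_perm_graph[OF assms(1-3)]
  show ?case
    using ugraph_iso.uconnected_iff[OF ugraph_iso_wreath_graph_Suc[OF assms(1-3)]]
      Suc assms(4) wf wreath_graph_labeling
    by (blast intro: uconnected_rename_verts uconnected_replacement_product wf_replacement_product)
qed

theorem theorem2:
  fixes d :: nat and \<pi> :: "nat \<Rightarrow> nat \<Rightarrow> nat" and Q :: "(nat \<Rightarrow> nat) set"
  assumes "bij_betw \<pi> {1..d} Q"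
    and "\<And>p. p \<in> Q \<Longrightarrow> p permutes {1..d + 1}"
    and "\<And>p. p \<in> Q \<Longrightarrow> inv p \<in> Q"
  shows "(\<forall>n\<ge>1. same_graph (wreath_graph d \<pi> (n + 1))
            (rename_verts (\<lambda>(x, v). x # v)
              (replacement_product (wreath_graph d \<pi> n) fst (perm_graph d Q)))) \<and>
         (uconnected (perm_graph d Q) \<longrightarrow> (\<forall>n\<ge>1. uconnected (wreath_graph d \<pi> n)))"
proof -
  note assms' = assms(1) assms(2)[folded alphabet_def] assms(3)
  show ?thesis
    using ugraph_iso.same_graph[OF ugraph_iso_wreath_graph_Suc[OF assms']]
      uconnected_wreath_graph[OF assms'] by simp
qed

end
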